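(* Let $k\ge 1$ and $k\le r\le 2k$ be integers, and let $u_n^{(r)}=t_n^{(r)}-t_{n-1}^{(r)}$ for $n\ge 2$. Then $$u_n^{(r)}=\frac{-2(n+k)}{n(n+2k+1)}\cdot\sum_{i=1}^k u_{n-i}^{(r)}\qquad\text{for all } n\ge k+2,$$ and the initial values for $2\le n\le k+1$ are $$u_n^{(r)}=\begin{cases}0 & \text{if } 2\le n\le r-k,\\ \dfrac{1}{(r-k+1)(r+k+2)} & \text{if } n=r-k+1 \text{ and } r\ge k+1,\\ \dfrac{1}{n(n+2k+1)}-\dfrac{1}{(n-1)(n+2k)} & \text{if } r-k+2\le n\le k+1.\end{cases}$$
   Context: Parking process. Fix an integer $k\ge 1$. For an integer $n\ge 1$ consider a row of $n+k-1$ parking slots labelled $1,2,\dots,n+k-1$. Cars arrive one by one. At any stage a slot is available if, after occupying it, every gap between neighboring occupied slots, as well as the gap before the first occupied slot and the gap after the last occupied slot, contains at least $k$ unoccupied slots (equivalently, distinct occupied slots are at distance at least $k+1$ and there are at least $k$ unoccupied slots at each end of the row). Each arriving car occupies one of the currently available slots, chosen uniformly at random among them (given the past). The process stops when no slot is available. A gap is a maximal block of consecutive unoccupied slots in the final configuration (between neighboring cars, before the first car, or after the last car; if no car can park, the whole row is a single gap). The final gaps have sizes in $\{k,k+1,\dots,2k\}$; an $r$-gap is a gap consisting of exactly $r$ slots. For $k\le r\le 2k$ and $n\ge 1$, $a_n^{(r)}$ denotes the expected number of $r$-gaps at the end of the process on the row of $n+k-1$ slots. Notation. For $n\ge 1$: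 $s_n^{(r)}=\sum_{i=1}^n a_i^{(r)}$ and $t_n^{(r)}=\dfrac{s_n^{(r)}}{n(n+2k+1)}$. *)

theory Defs
  imports "HOL-Probability.Probability"
begin

text \<open>
  A row has slots \<open>1, \<dots>, N\<close>; a configuration is the set \<open>S\<close> of occupied slots. Adding the two
  fictitious borders \<open>0\<close> and \<open>N + 1\<close>, a gap is represented by the pair \<open>(a, b)\<close> of neighbouring
  points enclosing it, so it consists of the \<open>b - a - 1\<close> slots strictly between \<open>a\<close> and \<open>b\<close>. This
  includes the gaps before the first and after the last car. Pairs with \<open>b = a + 1\<close> are empty gaps,
  which have to be present for the admissibility condition of the parking rule.
\<close>

definition gaps :: "nat \<Rightarrow> nat set \<Rightarrow> (nat \<times> nat) set" where
  "gaps N S = {(a, b). a \<in> S \<union> {0, N + 1} \<and> b \<in> S \<union> {0, N + 1} \<and> a < b \<and>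
                       (\<forall>c \<in> S \<union> {0, N + 1}. \<not> (a < c \<and> c < b))}"

definition gap_size :: "nat \<times> nat \<Rightarrow> nat" where
  "gap_size g = snd g - fst g - 1"

definition available :: "nat \<Rightarrow> nat \<Rightarrow> nat set \<Rightarrow> nat set" where
  "available k N S = {i \<in> {1..N} - S. \<forall>g \<in> gaps N (insert i S). k \<le> gap_size g}"

lemma finite_available: "finite (available k N S)"
  by (simp add: available_def)

function final_config :: "nat \<Rightarrow> nat \<Rightarrow> nat set \<Rightarrow> nat set pmf" where
  "final_config k N S =
     (if available k N S = {} then return_pmf S
      else bind_pmf (pmf_of_set (available k N S)) (\<lambda>i. final_config k N (insert i S)))"
  by pat_completeness auto
termination
proof (relation "Wellfounded.measure (\<lambda>(k, N, S). card ({1..N} - S))", goal_cases)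
  case (2 k N S i)
  then have "i \<in> {1..N} - S"
    by (auto simp: set_pmf_of_set finite_available available_def)
  then have "{1..N} - insert i S \<subset> {1..N} - S"
    by blast
  then have "card ({1..N} - insert i S) < card ({1..N} - S)"
    by (intro psubset_card_mono) simp_all
  then show ?case
    by (simp del: card_Diff_insert)
qed auto

declare final_config.simps [simp del]

definition num_gaps :: "nat \<Rightarrow> nat \<Rightarrow> nat set \<Rightarrow> nat" where
  "num_gaps r N S = card {g \<in> gaps N S. gap_size g = r}"

definition expected_gaps :: "nat \<Rightarrow> nat \<Rightarrow> nat \<Rightarrow> real" where
  "expected_gaps k r n =
     measure_pmf.expectation (final_config k (n + k - 1) {}) (\<lambda>S. real (num_gaps r (n + k - 1) S))"

definition gap_sum :: "nat \<Rightarrow> nat \<Rightarrow> nat \<Rightarrow> real" where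
  "gap_sum k r n = (\<Sum>i = 1..n. expected_gaps k r i)"

definition gap_quot :: "nat \<Rightarrow> nat \<Rightarrow> nat \<Rightarrow> real" where
  "gap_quot k r n = gap_sum k r n / (real n * (real n + 2 * real k + 1))"

text \<open>Only meaningful for \<open>n \<ge> 2\<close>.\<close>

definition gap_diff :: "nat \<Rightarrow> nat \<Rightarrow> nat \<Rightarrow> real" where
  "gap_diff k r n = gap_quot k r n - gap_quot k r (n - 1)"

end

(* Let gap_mean L be the expected number of r-gaps produced by an empty row of L slots, defined by
   conditioning on the first car. If all gaps of a configuration S have size at least k, the slots
   available for S are exactly those available inside its gaps, and averaging over the slots inside
   one gap leaves the total gap_mean of its two parts equal to that of the gap. Hence the sum of
   gap_mean over all gaps does not change on average when a car parks (a martingale), so its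
   initial value is the expected final number of r-gaps. This gives a_n = 2 s_(n-k-1) / (n-k-1) for
   n >= k+2, and substituting s_n = n(n+2k+1) t_n turns it into the recurrence for u_n, because
   n(n+2k+1) - (n-1)(n+2k) = 2(n+k). *)

theory Submission
  imports Defs
begin

section \<open>Mean number of gaps in an empty row\<close>

text \<open>With more than \<open>2 * k\<close> slots, the first car has \<open>L - 2 * k\<close>
  choices. Its left and right parts each run through the sizes from \<open>k\<close> to
  \<open>L - k - 1\<close>, so by reflection both contribute the same sum, whence the factor 2. In a
  shorter row no car fits and the row itself is the only gap.\<close>

function gap_mean :: "nat \<Rightarrow> nat \<Rightarrow> nat \<Rightarrow> real" where
  "gap_mean k r L =
     (if L \<le> 2 * k then of_bool (L = r)
      else 2 / real (L - 2 * k) * (\<Sum>j\<in>{k..<L - k}. gap_mean k r j))"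
  by pat_completeness auto
termination
  by (relation "Wellfounded.measure (\<lambda>(k, r, L). L)") auto

declare gap_mean.simps [simp del]

lemma gap_mean_small: "L \<le> 2 * k \<Longrightarrow> gap_mean k r L = of_bool (L = r)"
  by (simp add: gap_mean.simps)

text \<open>This is the defining recursion of \<open>gap_mean\<close>, translated to a gap with ends
  \<open>a\<close> and \<open>b\<close> and cleared of its denominator. The index set consists of
  the slots leaving at least \<open>k\<close> free slots on either side; for a gap of at most
  \<open>2 * k\<close> slots it is empty and both sides vanish.\<close>

lemma sum_gap_mean_split:
  fixes a b k r :: nat
  shows "(\<Sum>i\<in>{a + k<..<b - k}. gap_mean k r (i - a - 1) + gap_mean k r (b - i - 1)) =
         real (card {a + k<..<b - k}) * gap_mean k r (b - a - 1)"
proof (cases "b - a - 1 \<le> 2 * k")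
  case True
  then have "{a + k<..<b - k} = {}"
    by auto
  then show ?thesis
    by (simp only: sum.empty card.empty of_nat_0 mult_zero_left)
next
  case False
  define L where "L = b - a - 1"
  have L: "L > 2 * k" "b = a + L + 1"
    using False by (auto simp: L_def)
  have "(\<Sum>i\<in>{a + k<..<b - k}. gap_mean k r (i - a - 1)) = (\<Sum>j\<in>{k..<L - k}. gap_mean k r j)"
    using L by (intro sum.reindex_bij_witness[of _ "\<lambda>j. j + a + 1" "\<lambda>i. i - a - 1"]) auto
  moreover have "(\<Sum>i\<in>{a + k<..<b - k}. gap_mean k r (b - i - 1)) = (\<Sum>j\<in>{k..<L - k}. gap_mean k r j)"
    using L by (intro sum.reindex_bij_witness[of _ "\<lambda>j. b - j - 1" "\<lambda>i. b - i - 1"]) auto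
  moreover have "card {a + k<..<b - k} = L - 2 * k"
    using L by simp
  ultimately show ?thesis
    using L gap_mean.simps[of k r L]
    by (simp add: sum.distrib L_def[symmetric])
qed

section \<open>Gaps and the effect of one more car\<close>

lemma finite_gaps: "S \<subseteq> {1..N} \<Longrightarrow> finite (gaps N S)"
  by (rule finite_subset[of _ "{0..N + 1} \<times> {0..N + 1}"]) (auto simp: gaps_def)

lemma gaps_empty: "gaps N {} = {(0, N + 1)}"
  by (auto simp: gaps_def)

text \<open>The ends are the nearest points on either side of \<open>i\<close> among cars and
  borders; they exist because the borders \<open>0\<close> and \<open>N + 1\<close> enclose
  \<open>i\<close>.\<close>

lemma gap_around:
  assumes "S \<subseteq> {1..N}" and "i \<in> {1..N} - S"
  obtains a b where "(a, b) \<in> gaps N S" "a < i" "i < b"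
proof -
  let ?P = "S \<union> {0, N + 1}"
  let ?A = "{x \<in> ?P. x < i}" and ?B = "{x \<in> ?P. i < x}"
  have fin: "finite ?P"
    using assms(1) finite_subset by auto
  have A: "finite ?A" "?A \<noteq> {}" and B: "finite ?B" "?B \<noteq> {}"
    using fin assms(2) by auto
  have "Max ?A \<in> ?A" "Min ?B \<in> ?B"
    using Max_in[OF A] Min_in[OF B] by blast+
  moreover have "\<not> (Max ?A < c \<and> c < Min ?B)" if "c \<in> ?P" for c
  proof
    assume c: "Max ?A < c \<and> c < Min ?B"
    have "c \<noteq> i"
      using that assms(2) by auto
    then have "c \<in> ?A \<or> c \<in> ?B"
      using that by auto
    then show False
      using Max_ge[OF A(1), of c] Min_le[OF B(1), of c] c by linarith
  qed
  ultimately have "(Max ?A, Min ?B) \<in> gaps N S" "Max ?A < i" "i < Min ?B"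
    unfolding gaps_def by auto
  then show ?thesis
    by (rule that)
qed

text \<open>If the ends differed, an end of one gap would lie strictly inside the other: for
  example, \<open>a < c\<close> gives \<open>a < c < i < b\<close>.\<close>

lemma gaps_disjoint:
  assumes "(a, b) \<in> gaps N S" "(c, d) \<in> gaps N S" "a < i" "i < b" "c < i" "i < d"
  shows "(a, b) = (c, d)"
proof -
  have "\<not> a < c" "\<not> c < a" "\<not> b < d" "\<not> d < b"
    using assms unfolding gaps_def by force+
  then show ?thesis
    by simp
qed

lemma gaps_insert:
  assumes "(a, b) \<in> gaps N S" "a < i" "i < b"
  shows "gaps N (insert i S) = insert (a, i) (insert (i, b) (gaps N S - {(a, b)}))"
proof -
  define P where "P = S \<union> {0, N + 1}"
  have old: "(x, y) \<in> gaps N S \<longleftrightarrow> x \<in> P \<and> y \<in> P \<and> x < y \<and> (\<forall>c\<in>P. \<not> (x < c \<and> c < y))" for x y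
    by (simp add: gaps_def P_def)
  have new: "(x, y) \<in> gaps N (insert i S) \<longleftrightarrow> x \<in> insert i P \<and> y \<in> insert i P \<and> x < y \<and>
      (\<forall>c\<in>insert i P. \<not> (x < c \<and> c < y))" for x y
    by (auto simp: gaps_def P_def)
  have ab: "a \<in> P" "b \<in> P" and none: "\<And>c. c \<in> P \<Longrightarrow> c \<le> a \<or> b \<le> c"
    using assms(1) unfolding old by force+
  have "(x, y) \<in> gaps N (insert i S) \<longleftrightarrow>
      (x, y) = (a, i) \<or> (x, y) = (i, b) \<or> (x, y) \<in> gaps N S \<and> (x, y) \<noteq> (a, b)" (is "?L \<longleftrightarrow> ?R") for x y
  proof
    assume L: ?L
    then have xy: "x \<in> insert i P" "y \<in> insert i P" "x < y"
      and between: "\<And>c. c \<in> insert i P \<Longrightarrow> c \<le> x \<or> y \<le> c"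
      unfolding new by force+
    consider "x = i" | "y = i" | "x \<noteq> i" "y \<noteq> i"
      by blast
    then show ?R
    proof cases
      case 1
      then have "y = b"
        using xy between[of b] none[of y] ab assms(2,3) by auto
      then show ?thesis
        using 1 by simp
    next
      case 2
      then have "x = a"
        using xy between[of a] none[of x] ab assms(2,3) by auto
      then show ?thesis
        using 2 by simp
    next
      \<comment> \<open>Neighbours other than \<open>i\<close> were already neighbours before the
        insertion, and they are not \<open>a\<close> and \<open>b\<close>, since \<open>i\<close>
        now separates these two.\<close>
      case 3
      then show ?thesis
        using L between[of i] assms(2,3) unfolding old new by auto
    qed
  next
    assume ?R
    then consider "x = a" "y = i" | "x = i" "y = b" | "(x, y) \<in> gaps N S" "(x, y) \<noteq> (a, b)"
      by blast
    then show ?L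
    proof cases
      case 1
      then show ?thesis
        unfolding new using ab none assms(2,3) by fastforce
    next
      case 2
      then show ?thesis
        unfolding new using ab none assms(2,3) by fastforce
    next
      case 3
      then have "\<not> (x < i \<and> i < y)"
        using gaps_disjoint[OF _ assms(1), of x y i] assms(2,3) by blast
      then show ?thesis
        using 3(1) unfolding old new by auto
    qed
  qed
  then show ?thesis
    by auto
qed

text \<open>Since \<open>i\<close> was neither a car nor a border, no earlier gap ends at
  \<open>i\<close>. Hence both pairs created by the split are new and each contributes exactly
  once.\<close>

lemma sum_gaps_insert:
  fixes h :: "nat \<times> nat \<Rightarrow> real"
  assumes "S \<subseteq> {1..N}" "i \<notin> S" "(a, b) \<in> gaps N S" "a < i" "i < b"
  shows "sum h (gaps N (insert i S)) = sum h (gaps N S) + (h (a, i) + h (i, b) - h (a, b))"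
proof -
  have i: "i \<noteq> 0" "i \<noteq> N + 1"
    using assms unfolding gaps_def by auto
  have "(a, i) \<notin> gaps N S" "(i, b) \<notin> gaps N S"
    using assms(2) i unfolding gaps_def by auto
  then show ?thesis
    using assms finite_gaps[OF assms(1)]
    by (simp add: gaps_insert[OF assms(3-5)] sum_diff1)
qed

section \<open>Available slots and the martingale step\<close>

text \<open>The invariant of the parking process. It makes availability of a slot a local question
  about the gap that contains it.\<close>

definition spaced :: "nat \<Rightarrow> nat \<Rightarrow> nat set \<Rightarrow> bool" where
  "spaced k N S \<longleftrightarrow> S \<subseteq> {1..N} \<and> (\<forall>g \<in> gaps N S. k \<le> gap_size g)"

lemma spaced_insert: "spaced k N S \<Longrightarrow> i \<in> available k N S \<Longrightarrow> spaced k N (insert i S)"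
  by (auto simp: spaced_def available_def)

lemma gap_in_range: "S \<subseteq> {1..N} \<Longrightarrow> (a, b) \<in> gaps N S \<Longrightarrow> a < i \<Longrightarrow> i < b \<Longrightarrow> i \<in> {1..N} - S"
  by (force simp: gaps_def)

text \<open>Parking at \<open>i\<close> replaces only the gap around \<open>i\<close>, and
  \<open>spaced\<close> takes care of all others. What remains of the parking rule is that both new
  parts have at least \<open>k\<close> slots.\<close>

lemma available_eq_Union:
  assumes "spaced k N S"
  shows "available k N S = (\<Union>g\<in>gaps N S. {fst g + k<..<snd g - k})"
proof (intro equalityI subsetI)
  fix i assume i: "i \<in> available k N S"
  then have iN: "i \<in> {1..N} - S"
    by (auto simp: available_def)
  obtain a b where ab: "(a, b) \<in> gaps N S" "a < i" "i < b"
    using gap_around[of S N i] assms iN by (auto simp: spaced_def)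
  have "k \<le> gap_size (a, i)" "k \<le> gap_size (i, b)"
    using i by (auto simp: available_def gaps_insert[OF ab])
  then have "i \<in> {a + k<..<b - k}"
    using ab by (auto simp: gap_size_def)
  then show "i \<in> (\<Union>g\<in>gaps N S. {fst g + k<..<snd g - k})"
    using ab(1) by force
next
  fix i assume "i \<in> (\<Union>g\<in>gaps N S. {fst g + k<..<snd g - k})"
  then obtain a b where ab: "(a, b) \<in> gaps N S" "a + k < i" "i < b - k"
    by force
  then have ab': "a < i" "i < b"
    by auto
  show "i \<in> available k N S"
    using assms ab gap_in_range[OF _ ab(1) ab', of]
    by (auto simp: available_def spaced_def gaps_insert[OF ab(1) ab'] gap_size_def)
qed

lemma sum_available_gap_mean:
  fixes r :: nat
  assumes "spaced k N S"
  defines "F \<equiv> \<lambda>g. gap_mean k r (gap_size g)"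
  shows "(\<Sum>i\<in>available k N S. sum F (gaps N (insert i S))) =
         real (card (available k N S)) * sum F (gaps N S)"
proof -
  let ?W = "\<lambda>g. {fst g + k<..<snd g - k}"
  have S: "S \<subseteq> {1..N}"
    using assms(1) by (simp add: spaced_def)
  \<comment> \<open>Passing to increments makes the sum local: \<open>D i\<close> depends only on
    the gap containing \<open>i\<close>, so the sum over available slots can be taken gap by
    gap.\<close>
  define D where "D i = sum F (gaps N (insert i S)) - sum F (gaps N S)" for i
  have "sum D (\<Union>g\<in>gaps N S. ?W g) = (\<Sum>g\<in>gaps N S. sum D (?W g))"
  proof (rule sum.UNION_disjoint)
    show "\<forall>g\<in>gaps N S. \<forall>g'\<in>gaps N S. g \<noteq> g' \<longrightarrow> ?W g \<inter> ?W g' = {}"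
    proof (intro ballI impI, rule ccontr)
      fix g g' assume g: "g \<in> gaps N S" "g' \<in> gaps N S" "g \<noteq> g'" "?W g \<inter> ?W g' \<noteq> {}"
      then obtain i where "i \<in> ?W g" "i \<in> ?W g'"
        by blast
      then have "fst g < i" "i < snd g" "fst g' < i" "i < snd g'"
        by auto
      then show False
        using g gaps_disjoint[of "fst g" "snd g" N S "fst g'" "snd g'" i] by simp
    qed
  qed (use finite_gaps[OF S] in auto)
  also have "\<dots> = 0"
  proof (rule sum.neutral, rule ballI)
    fix g assume g: "g \<in> gaps N S"
    obtain a b where ab: "g = (a, b)"
      by (cases g)
    have "sum D (?W g) = (\<Sum>i\<in>{a + k<..<b - k}. (F (a, i) + F (i, b)) - F (a, b))"
    proof (rule sum.cong)
      fix i assume "i \<in> {a + k<..<b - k}"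
      then have i: "a < i" "i < b"
        by auto
      then have "i \<notin> S"
        using gap_in_range[OF S g[unfolded ab] i] by auto
      then show "D i = (F (a, i) + F (i, b)) - F (a, b)"
        using sum_gaps_insert[OF S _ g[unfolded ab] i, of F] by (simp add: D_def)
    qed (simp add: ab)
    \<comment> \<open>The average over the slots of a single gap is preserved by
      \<open>sum_gap_mean_split\<close>.\<close>
    also have "\<dots> = 0"
      using sum_gap_mean_split[where a = a and b = b and k = k and r = r]
      unfolding sum_subtractf by (simp add: F_def gap_size_def)
    finally show "sum D (?W g) = 0" .
  qed
  finally have "sum D (available k N S) = 0"
    by (simp add: available_eq_Union[OF assms(1)])
  then show ?thesis
    by (simp add: D_def sum_subtractf)
qed

section \<open>Expectation at the end of the process\<close>

text \<open>Finite support is what allows the expectation to be split over the choice of the next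
  car.\<close>

lemma finite_set_final_config: "finite (set_pmf (final_config k N S))"
proof (induction k N S rule: final_config.induct)
  case (1 k N S)
  show ?case
  proof (cases "available k N S = {}")
    case True
    then show ?thesis
      by (simp add: final_config.simps[of k N S])
  next
    case False
    then show ?thesis
      using 1 by (simp add: final_config.simps[of k N S] finite_available)
  qed
qed

text \<open>Stated for every \<open>spaced\<close> configuration, not just the empty row, so that
  the induction can follow the process. When it stops, \<open>gap_mean\<close> is the indicator of
  size \<open>r\<close> on each gap; before that, the sum is preserved on average.\<close>

lemma expectation_num_gaps:
  assumes "spaced k N S"
  shows "measure_pmf.expectation (final_config k N S) (\<lambda>T. real (num_gaps r N T)) =
         (\<Sum>g\<in>gaps N S. gap_mean k r (gap_size g))"
  using assms
proof (induction k N S rule: final_config.induct)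
  case (1 k N S)
  show ?case
  proof (cases "available k N S = {}")
    case True
    have "gap_mean k r (gap_size g) = of_bool (gap_size g = r)" if "g \<in> gaps N S" for g
    proof (rule gap_mean_small, rule ccontr)
      assume "\<not> gap_size g \<le> 2 * k"
      \<comment> \<open>The leftmost slot with \<open>k\<close> free slots before it would still be
        available in a gap of more than \<open>2 * k\<close> slots.\<close>
      then have "fst g + k + 1 \<in> {fst g + k<..<snd g - k}"
        by (auto simp: gap_size_def)
      then show False
        using True that available_eq_Union[OF 1(2)] by blast
    qed
    moreover have "finite (gaps N S)"
      using 1(2) by (simp add: spaced_def finite_gaps)
    ultimately show ?thesis
      using True by (simp add: final_config.simps[of k N S] num_gaps_def
          sum_of_bool_eq Int_def)
  next
    case False
    have IH: "measure_pmf.expectation (final_config k N (insert i S)) (\<lambda>T. real (num_gaps r N T)) =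
        (\<Sum>g\<in>gaps N (insert i S). gap_mean k r (gap_size g))" if "i \<in> available k N S" for i
      using 1 False that by (simp add: finite_available spaced_insert)
    have "final_config k N S =
        pmf_of_set (available k N S) \<bind> (\<lambda>i. final_config k N (insert i S))"
      using False by (simp add: final_config.simps[of k N S])
    then have "measure_pmf.expectation (final_config k N S) (\<lambda>T. real (num_gaps r N T)) =
        (\<Sum>i\<in>available k N S. measure_pmf.expectation (final_config k N (insert i S))
            (\<lambda>T. real (num_gaps r N T)) /\<^sub>R real (card (available k N S)))"
      using False
      by (simp add: pmf_expectation_bind_pmf_of_set finite_available finite_set_final_config)
    also have "\<dots> = (\<Sum>i\<in>available k N S. \<Sum>g\<in>gaps N (insert i S). gap_mean k r (gap_size g)) /
        real (card (available k N S))"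
      by (simp add: IH divide_inverse mult.commute flip: sum_distrib_left)
    also have "\<dots> = (\<Sum>g\<in>gaps N S. gap_mean k r (gap_size g))"
      using False by (simp add: sum_available_gap_mean[OF 1(2)] finite_available)
    finally show ?thesis .
  qed
qed

section \<open>Recurrence and initial values of the expectations\<close>

text \<open>The empty row is a single gap of \<open>n + k - 1\<close> slots, and
  \<open>1 \<le> n\<close> makes it long enough to be \<open>spaced\<close>.\<close>

lemma expected_gaps_eq_gap_mean:
  assumes "1 \<le> n"
  shows "expected_gaps k r n = gap_mean k r (n + k - 1)"
  unfolding expected_gaps_def using assms
  by (subst expectation_num_gaps) (auto simp: spaced_def gaps_empty gap_size_def)

lemma expected_gaps_small:
  assumes "1 \<le> n" "n \<le> k + 1"
  shows "expected_gaps k r n = of_bool (n + k = r + 1)"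
  using assms by (auto simp: expected_gaps_eq_gap_mean gap_mean_small)

text \<open>The row has more than \<open>2 * k\<close> slots, so \<open>gap_mean\<close> recurses. A
  part of \<open>j\<close> slots is the row belonging to the index \<open>j + 1 - k\<close>, and
  these indices run from 1 to \<open>n - k - 1\<close>.\<close>

lemma expected_gaps_rec:
  assumes "k + 2 \<le> n"
  shows "expected_gaps k r n = 2 / real (n - k - 1) * gap_sum k r (n - k - 1)"
proof -
  have "gap_sum k r (n - k - 1) = (\<Sum>j\<in>{k..<n - 1}. gap_mean k r j)"
    unfolding gap_sum_def
    by (intro sum.reindex_bij_witness[of _ "\<lambda>j. j + 1 - k" "\<lambda>i. i + k - 1"])
      (use assms in \<open>auto simp: expected_gaps_eq_gap_mean\<close>)
  moreover have "n + k - 1 - 2 * k = n - k - 1" "n + k - 1 - k = n - 1"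
    by auto
  moreover have "expected_gaps k r n = gap_mean k r (n + k - 1)" "\<not> n + k - 1 \<le> 2 * k"
    using assms by (auto simp: expected_gaps_eq_gap_mean)
  ultimately show ?thesis
    by (simp only: gap_mean.simps[of k r "n + k - 1"] if_False)
qed

text \<open>In this range no car fits, so the only nonzero summand is the one whose row has exactly
  \<open>r\<close> slots, at index \<open>r - k + 1\<close>.\<close>

lemma gap_sum_small:
  assumes "n \<le> k + 1" "k \<le> r"
  shows "gap_sum k r n = of_bool (r - k + 1 \<le> n)"
proof -
  have "gap_sum k r n = (\<Sum>i = 1..n. if i = r - k + 1 then 1 else 0)"
    unfolding gap_sum_def
    by (intro sum.cong) (use assms in \<open>auto simp: expected_gaps_small\<close>)
  then show ?thesis
    by (simp add: sum.delta)
qed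

section \<open>From the expectations to the differences\<close>

lemma gap_diff_rec:
  assumes "k + 2 \<le> n"
  shows "gap_diff k r n =
    - 2 * (real n + real k) / (real n * (real n + 2 * real k + 1)) *
      (\<Sum>i = 1..k. gap_diff k r (n - i))"
proof -
  define t where "t = gap_quot k r"
  have s: "gap_sum k r m = real m * (real m + 2 * real k + 1) * t m" if "1 \<le> m" for m
  proof -
    have "real m * (real m + 2 * real k + 1) \<noteq> 0"
      using that by (simp add: add_nonneg_eq_0_iff)
    then show ?thesis
      by (simp add: t_def gap_quot_def)
  qed
  have tele: "(\<Sum>i = 1..k. gap_diff k r (n - i)) = t (n - 1) - t (n - k - 1)"
    \<comment> \<open>The minus sign compensates for the index \<open>n - 1 - i\<close> decreasing
      as \<open>i\<close> grows.\<close>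
    using sum_telescope'' [of 0 k "\<lambda>i. - t (n - 1 - i)"]
    by (simp add: gap_diff_def t_def atLeastSucAtMost_greaterThanAtMost[symmetric] add.commute)
  obtain m where m: "n = m + k + 1" "1 \<le> m"
    using assms by (intro that[of "n - k - 1"]) auto
  have "gap_sum k r n = gap_sum k r (n - 1) + expected_gaps k r n"
    using m by (simp add: gap_sum_def)
  \<comment> \<open>With \<open>m = n - k - 1\<close>, the factor \<open>m\<close> in
    \<open>gap_sum k r m\<close> cancels, and the other factor \<open>m + 2 * k + 1\<close> equals
    \<open>n + k\<close>.\<close>
  also have "expected_gaps k r n = 2 * (real n + real k) * t m"
    using expected_gaps_rec[OF assms, of r] m s[of m] by simp
  finally have "real n * (real n + 2 * real k + 1) * t n =
      (real n - 1) * (real n + 2 * real k) * t (n - 1) + 2 * (real n + real k) * t m"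
    using s[of n] s[of "n - 1"] m by (simp add: algebra_simps)
  \<comment> \<open>Subtracting \<open>n * (n + 2 * k + 1) * t (n - 1)\<close> from both sides
    leaves \<open>2 * (n + k) * (t m - t (n - 1))\<close> on the right, which is the telescoped sum
    up to sign.\<close>
  then have "real n * (real n + 2 * real k + 1) * gap_diff k r n =
      - 2 * (real n + real k) * (\<Sum>i = 1..k. gap_diff k r (n - i))"
    using m unfolding tele by (simp add: gap_diff_def t_def[symmetric] algebra_simps)
  moreover have "real n * (real n + 2 * real k + 1) \<noteq> 0"
    using assms by (simp add: add_nonneg_eq_0_iff)
  ultimately show ?thesis
    by (simp add: field_simps)
qed

theorem mainTheorem2:
  fixes k r :: nat
  assumes "1 \<le> k" and "k \<le> r" and "r \<le> 2 * k"
  shows "(\<forall>n \<ge> k + 2.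
            gap_diff k r n =
              - 2 * (real n + real k) / (real n * (real n + 2 * real k + 1)) *
              (\<Sum>i = 1..k. gap_diff k r (n - i))) \<and>
         (\<forall>n. 2 \<le> n \<and> n \<le> k + 1 \<longrightarrow>
            (n \<le> r - k \<longrightarrow> gap_diff k r n = 0) \<and>
            (n = r - k + 1 \<and> k + 1 \<le> r \<longrightarrow>
               gap_diff k r n = 1 / ((real r - real k + 1) * (real r + real k + 2))) \<and>
            (r - k + 2 \<le> n \<longrightarrow>
               gap_diff k r n =
                 1 / (real n * (real n + 2 * real k + 1)) -
                 1 / ((real n - 1) * (real n + 2 * real k))))"
proof (intro conjI allI impI)
  fix n assume "k + 2 \<le> n"
  then show "gap_diff k r n =
      - 2 * (real n + real k) / (real n * (real n + 2 * real k + 1)) *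
      (\<Sum>i = 1..k. gap_diff k r (n - i))"
    by (rule gap_diff_rec)
next
  fix n assume n: "2 \<le> n \<and> n \<le> k + 1"
  then have n1: "n - 1 \<le> k + 1"
    by linarith
  \<comment> \<open>For these \<open>n\<close>, \<open>gap_sum\<close> is a unit step at
    \<open>r - k + 1\<close>. The three cases of the claim correspond to the step lying beyond
    \<open>n\<close>, exactly at \<open>n\<close>, or at most at \<open>n - 1\<close>.\<close>
  have diff: "gap_diff k r n = of_bool (r - k + 1 \<le> n) / (real n * (real n + 2 * real k + 1)) -
      of_bool (r - k + 1 \<le> n - 1) / ((real n - 1) * (real n + 2 * real k))"
    using n gap_sum_small[of n k r] gap_sum_small[OF n1 assms(2)] assms(2)
    by (simp add: gap_diff_def gap_quot_def of_nat_diff)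
  show "gap_diff k r n = 0" if "n \<le> r - k"
  proof -
    have "\<not> r - k + 1 \<le> n" "\<not> r - k + 1 \<le> n - 1"
      using that by linarith+
    then show ?thesis
      by (simp only: diff of_bool_eq div_0 diff_self)
  qed
  show "gap_diff k r n = 1 / ((real r - real k + 1) * (real r + real k + 2))"
    if "n = r - k + 1 \<and> k + 1 \<le> r"
  proof -
    have "real n = real r - real k + 1" "real n + 2 * real k + 1 = real r + real k + 2"
      using that by (auto simp: of_nat_diff)
    moreover have "r - k + 1 \<le> n" "\<not> r - k + 1 \<le> n - 1"
      using that by linarith+
    ultimately show ?thesis
      by (simp only: diff of_bool_eq div_0 diff_zero)
  qed
  show "gap_diff k r n = 1 / (real n * (real n + 2 * real k + 1)) -
      1 / ((real n - 1) * (real n + 2 * real k))" if "r - k + 2 \<le> n"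
    using that by (simp add: diff)
qed

end
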